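(* Let $f:[a,b]\to\mathbb{R}$ be a continuous function of bounded variation. Then $\omega_f\le\omega_{\mathrm{Var}_f}$ (pointwise on $[0,\infty)$).
   Context: For $f:[a,b]\to\mathbb{R}$, the variation is $$\mathrm{Var}(f;a,b):=\sup\Big\{\sum_{i=1}^n|f(x_i)-f(x_{i-1})| : a=x_0\le x_1\le\dots\le x_n=b \text{ for some } n\in\mathbb{N}\Big\}.$$ The function $f$ is of bounded variation if $\mathrm{Var}(f;a,b)<\infty$; in that case its variation function is $\mathrm{Var}_f:[a,b]\to\mathbb{R}$, $\mathrm{Var}_f(x):=\mathrm{Var}(f;a,x)$. For an interval $\mathcal{I}\subset\mathbb{R}$ and a continuous function $g:\mathcal{I}\to\mathbb{R}$, the minimal modulus of continuity of $g$ is, for $h\ge 0$, $$\omega_g(h):=\sup\{|g(x)-g(y)| : x,y\in\mathcal{I},\ |x-y|\le h\}.$$ A function $f$ of bounded variation on $[a,b]$ is continuous if and only if $\mathrm{Var}_f$ is continuous, so $\omega_{\mathrm{Var}_f}$ is defined. *)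

theory Defs
  imports "HOL-Analysis.Analysis"
begin

(* Both suprema are taken in the extended reals, so that they equal \<infinity> on unbounded
   sets instead of an unspecified real number. Functions on an interval are total functions
   of which only the values on that interval are used. *)

definition variation :: "(real \<Rightarrow> real) \<Rightarrow> real \<Rightarrow> real \<Rightarrow> ereal" where
  "variation f a b =
     Sup {ereal (\<Sum>i=1..n. \<bar>f (x i) - f (x (i - 1))\<bar>) | (n::nat) (x::nat \<Rightarrow> real).
            n \<ge> 1 \<and> x 0 = a \<and> x n = b \<and> (\<forall>i\<in>{1..n}. x (i - 1) \<le> x i)}"

definition bounded_variation_on :: "(real \<Rightarrow> real) \<Rightarrow> real \<Rightarrow> real \<Rightarrow> bool" where
  "bounded_variation_on f a b \<longleftrightarrow> variation f a b < \<infinity>"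

(* Meaningful for a \<le> x \<le> b when f is of bounded variation on [a,b]: then
   variation f a x is finite. *)
definition variation_function :: "(real \<Rightarrow> real) \<Rightarrow> real \<Rightarrow> real \<Rightarrow> real" where
  "variation_function f a x = real_of_ereal (variation f a x)"

definition modulus_of_continuity :: "real set \<Rightarrow> (real \<Rightarrow> real) \<Rightarrow> real \<Rightarrow> ereal" where
  "modulus_of_continuity I g h =
     Sup {ereal \<bar>g x - g y\<bar> | x y. x \<in> I \<and> y \<in> I \<and> \<bar>x - y\<bar> \<le> h}"

end

theory Submission
  imports Defs
begin

text \<open>Appending a point \<open>d \<ge> c\<close> to a partition of [a,c] gives a partition of
  [a,d] whose sum is larger by exactly the increment of f from c to d. Hence that increment is at
  most the growth of the variation from c to d (\<open>variation_add_increment_le\<close>). Bounded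
  variation makes this an inequality between real numbers
  (\<open>increment_le_variation_function\<close>). So every pair of points competing in the modulus
  of f contributes at least as much to that of the variation function, and the suprema
  compare.\<close>

lemma variation_add_increment_le:
  assumes "c \<le> d"
  shows "variation f a c + ereal \<bar>f d - f c\<bar> \<le> variation f a d"
proof -
  \<comment> \<open>The finite increment is moved to the right, so that a bound for each single
    partition suffices.\<close>
  have "variation f a c \<le> variation f a d - ereal \<bar>f d - f c\<bar>"
    unfolding variation_def[of f a c]
  proof (rule Sup_least, clarify)
    fix n :: nat and x :: "nat \<Rightarrow> real"
    assume n: "n \<ge> 1" and x: "c = x n" "a = x 0" "\<forall>i\<in>{1..n}. x (i - 1) \<le> x i"
    \<comment> \<open>The given partition, extended by \<open>d\<close> as the point of index
      \<open>Suc n\<close>; \<open>clarify\<close> has replaced \<open>a\<close> and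
      \<open>c\<close> by \<open>x 0\<close> and \<open>x n\<close>.\<close>
    define y where "y = (\<lambda>i. if i \<le> n then x i else d)"
    have "(\<Sum>i=1..n. \<bar>f (y i) - f (y (i - 1))\<bar>) = (\<Sum>i=1..n. \<bar>f (x i) - f (x (i - 1))\<bar>)"
      by (rule sum.cong) (auto simp: y_def)
    then have "(\<Sum>i=1..Suc n. \<bar>f (y i) - f (y (i - 1))\<bar>)
        = (\<Sum>i=1..n. \<bar>f (x i) - f (x (i - 1))\<bar>) + \<bar>f d - f (x n)\<bar>"
      by (simp add: y_def)
    moreover have "ereal (\<Sum>i=1..Suc n. \<bar>f (y i) - f (y (i - 1))\<bar>) \<le> variation f (x 0) d"
      unfolding variation_def
    proof (intro Sup_upper CollectI exI conjI ballI)
      fix i assume "i \<in> {1..Suc n}"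
      then show "y (i - 1) \<le> y i"
        using x assms by (cases "i = Suc n") (auto simp: y_def)
    qed (auto simp: y_def)
    ultimately show "ereal (\<Sum>i=1..n. \<bar>f (x i) - f (x (i - 1))\<bar>)
        \<le> variation f (x 0) d - ereal \<bar>f d - f (x n)\<bar>"
      by (simp add: ereal_le_minus)
  qed
  then show ?thesis
    by (simp add: ereal_le_minus)
qed

lemma variation_mono:
  assumes "c \<le> d"
  shows "variation f a c \<le> variation f a d"
proof -
  have "variation f a c \<le> variation f a c + ereal \<bar>f d - f c\<bar>"
    by (simp add: add_increasing2)
  then show ?thesis
    using variation_add_increment_le[OF assms] by (rule order_trans)
qed

text \<open>The partition with the two points a and c exists because \<open>a \<le> c\<close>; for c
  < a there is none, and the supremum of the empty set is -\<infinity>.\<close>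

lemma variation_nonneg:
  assumes "a \<le> c"
  shows "0 \<le> variation f a c"
proof -
  define x where "x = (\<lambda>i::nat. if i = 0 then a else c)"
  have "ereal (\<Sum>i=1..1. \<bar>f (x i) - f (x (i - 1))\<bar>) \<le> variation f a c"
    unfolding variation_def
    by (intro Sup_upper CollectI exI[of _ 1] exI[of _ x] conjI refl) (use assms in \<open>auto simp: x_def\<close>)
  then show ?thesis
    by (rule order_trans[rotated]) simp
qed

lemma increment_le_variation_function:
  assumes "bounded_variation_on f a b" "a \<le> y" "y \<le> x" "x \<le> b"
  shows "\<bar>f x - f y\<bar> \<le> \<bar>variation_function f a x - variation_function f a y\<bar>"
proof -
  \<comment> \<open>The variation up to z lies between 0 and the finite variation up to b.
    Finiteness matters because \<open>real_of_ereal\<close> sends infinite values to 0.\<close>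
  have fin: "\<bar>variation f a z\<bar> \<noteq> \<infinity>" if "a \<le> z" "z \<le> b" for z
    using variation_mono[OF that(2), of f a] variation_nonneg[OF that(1), of f] assms(1)
    by (auto simp: bounded_variation_on_def)
  then obtain r s where "variation f a x = ereal r" "variation f a y = ereal s"
    using assms by (metis ereal_real order_trans)
  then show ?thesis
    using variation_add_increment_le[OF assms(3), of f a] by (simp add: variation_function_def)
qed

theorem proposition5:
  fixes f :: "real \<Rightarrow> real" and a b :: real
  assumes "a \<le> b"
    and "continuous_on {a..b} f"
    and "bounded_variation_on f a b"
  shows "\<forall>h\<ge>0. modulus_of_continuity {a..b} f h
                 \<le> modulus_of_continuity {a..b} (variation_function f a) h"
proof (intro allI impI)
  fix h :: real
  show "modulus_of_continuity {a..b} f h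
          \<le> modulus_of_continuity {a..b} (variation_function f a) h"
    unfolding modulus_of_continuity_def
  \<comment> \<open>The same pair (x, y) serves as witness on the right; both sides are symmetric in
    x and y, so either order of the points is covered.\<close>
  proof (rule Sup_mono, clarify)
    fix x y assume xy: "x \<in> {a..b}" "y \<in> {a..b}" "\<bar>x - y\<bar> \<le> h"
    have "\<bar>f x - f y\<bar> \<le> \<bar>variation_function f a x - variation_function f a y\<bar>"
      using increment_le_variation_function[OF assms(3), of x y]
        increment_le_variation_function[OF assms(3), of y x] xy
      by (cases "y \<le> x") (auto simp: abs_minus_commute)
    with xy show "\<exists>v\<in>{ereal \<bar>variation_function f a x - variation_function f a y\<bar> | x y.
          x \<in> {a..b} \<and> y \<in> {a..b} \<and> \<bar>x - y\<bar> \<le> h}. ereal \<bar>f x - f y\<bar> \<le> v"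
      by (intro bexI[of _ "ereal \<bar>variation_function f a x - variation_function f a y\<bar>"]) auto
  qed
qed

end
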